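(* Let $k,n$ be integers with $k\ge1$ and $n>2k$, and let $\theta\in(0,1)$. For a $C^{2k,\theta}$-smooth bounded domain $\Omega\subset\mathbb{R}^n$, let $G_\Omega$ be the Green function of $(-\Delta)^k$ in $\Omega$ with Dirichlet boundary condition, and let $(G_\Omega)_-=\max(-G_\Omega,0)$ be its negative part. The following two assertions are equivalent: (i) There exists a constant $C(k,n,\theta)$ depending only on $k,n,\theta$ such that $$\|(G_\Omega)_-\|_{L^\infty(\Omega\times\Omega)}\le C(k,n,\theta)$$ for all $C^{2k,\theta}$-smooth bounded domains $\Omega\subset\mathbb{R}^n$. (ii) $G_\Omega\ge 0$ for all $C^{2k,\theta}$-smooth bounded domains $\Omega\subset\mathbb{R}^n$.
   Context: For a $C^{2k,\theta}$-smooth bounded domain $\Omega\subset\mathbb{R}^n$ with exterior unit normal $\nu$, the Green function of $(-\Delta)^k$ in $\Omega$ with Dirichlet boundary condition is the function $G_\Omega:\overline{\Omega}\times\overline{\Omega}\setminus\{(x,x):x\in\overline \Omega\}\to\mathbb{R}$ (understood as usual to be continuous off the diagonal) such that for every $f\in C^{0,\theta}(\overline \Omega)$ the unique solution $u\in C^{2k,\theta}(\overline \Omega)$ of $$(-\Delta)^k u=f\ \text{ in }\Omega,\qquad u=\partial_\nu u=\ldots=\partial_\nu^{(k-1)}u=0\ \text{ on }\partial \Omega$$ is given by $u(x)=\int_\Omega G_\Omega(x,y)f(y)\,dy$. *)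

theory Defs
  imports "HOL-Analysis.Analysis" "HOL-Probability.Essential_Supremum"
begin

definition dir_deriv :: "'a::euclidean_space \<Rightarrow> ('a \<Rightarrow> real) \<Rightarrow> 'a \<Rightarrow> real" where
  "dir_deriv v f = (\<lambda>x. frechet_derivative f (at x) v)"

definition laplacian :: "('a::euclidean_space \<Rightarrow> real) \<Rightarrow> 'a \<Rightarrow> real" where
  "laplacian f = (\<lambda>x. \<Sum>b\<in>Basis. dir_deriv b (dir_deriv b f) x)"

definition polyharmonic :: "nat \<Rightarrow> ('a::euclidean_space \<Rightarrow> real) \<Rightarrow> 'a \<Rightarrow> real" where
  "polyharmonic k = (\<lambda>f x. - laplacian f x) ^^ k"

text \<open>\<open>C_diff m S f\<close>: the function \<open>f\<close> is of class \<open>C\<^sup>m\<close> on the open set \<open>S\<close>.\<close>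

primrec C_diff :: "nat \<Rightarrow> 'a::euclidean_space set \<Rightarrow> ('a \<Rightarrow> real) \<Rightarrow> bool" where
  "C_diff 0 S f \<longleftrightarrow> continuous_on S f"
| "C_diff (Suc m) S f \<longleftrightarrow>
     (\<forall>x\<in>S. f differentiable (at x)) \<and> (\<forall>b\<in>Basis. C_diff m S (dir_deriv b f))"

text \<open>
  For open \<open>S\<close>, \<open>holder_closure m \<theta> S\<close> is the space of functions that are \<open>C\<close> of order
  \<open>(m, \<theta>)\<close> on the closure of \<open>S\<close>: all partial derivatives on \<open>S\<close> of order at most \<open>m\<close> extend
  continuously to the closure, and those of order \<open>m\<close> are uniformly \<open>\<theta>\<close>-Hoelder continuous.
  A list \<open>bs\<close> of basis vectors encodes the iterated partial derivative \<open>foldr dir_deriv bs f\<close>.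
  Elements are identified with their values on the closure; values outside are irrelevant.
\<close>

definition holder_closure ::
  "nat \<Rightarrow> real \<Rightarrow> 'a::euclidean_space set \<Rightarrow> ('a \<Rightarrow> real) set" where
  "holder_closure m \<theta> S = {f. C_diff m S f \<and> continuous_on (closure S) f \<and>
     (\<forall>bs. set bs \<subseteq> Basis \<and> length bs \<le> m \<longrightarrow>
        (\<exists>g. continuous_on (closure S) g \<and> (\<forall>x\<in>S. g x = foldr dir_deriv bs f x))) \<and>
     (\<forall>bs. set bs \<subseteq> Basis \<and> length bs = m \<longrightarrow>
        (\<exists>L. \<forall>x\<in>S. \<forall>y\<in>S.
           \<bar>foldr dir_deriv bs f x - foldr dir_deriv bs f y\<bar> \<le> L * dist x y powr \<theta>))}"

text \<open>
  A bounded domain whose boundary is flattened, near each of its points, by a homeomorphism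
  \<open>\<psi>\<close> such that \<open>\<psi>\<close> and its inverse \<open>\<phi>\<close> have components of Hoelder class \<open>(m, \<theta>)\<close>.
  Requiring the Hoelder bounds up to the closure of \<open>V\<close> and \<open>W\<close> rather than locally makes
  no difference, since \<open>V\<close> may be shrunk.
\<close>

definition holder_smooth_bounded_domain ::
  "nat \<Rightarrow> real \<Rightarrow> 'a::euclidean_space set \<Rightarrow> bool" where
  "holder_smooth_bounded_domain m \<theta> \<Omega> \<longleftrightarrow>
     open \<Omega> \<and> connected \<Omega> \<and> \<Omega> \<noteq> {} \<and> bounded \<Omega> \<and>
     (\<forall>x\<in>frontier \<Omega>. \<exists>V W (\<psi> :: 'a \<Rightarrow> 'a) \<phi>. \<exists>e\<in>Basis.
        open V \<and> x \<in> V \<and> open W \<and> homeomorphism V W \<psi> \<phi> \<and>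
        (\<forall>b\<in>Basis. (\<lambda>y. \<psi> y \<bullet> b) \<in> holder_closure m \<theta> V) \<and>
        (\<forall>b\<in>Basis. (\<lambda>z. \<phi> z \<bullet> b) \<in> holder_closure m \<theta> W) \<and>
        \<psi> ` (V \<inter> \<Omega>) = {z\<in>W. z \<bullet> e > 0} \<and>
        \<psi> ` (V \<inter> frontier \<Omega>) = {z\<in>W. z \<bullet> e = 0})"

text \<open>
  If \<open>\<Omega>\<close> is given near the boundary point \<open>x\<close> as the set where a \<open>C\<^sup>1\<close> function \<open>\<rho>\<close> with
  nonvanishing gradient \<open>g x\<close> is negative, the exterior unit normal is the normalised gradient;
  it does not depend on the choice of \<open>\<rho>\<close>.
\<close>

definition exterior_normal :: "'a::euclidean_space set \<Rightarrow> 'a \<Rightarrow> 'a" where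
  "exterior_normal \<Omega> x = (THE \<nu>. \<exists>U \<rho> g. open U \<and> x \<in> U \<and>
     (\<forall>y\<in>U. (\<rho> has_derivative (\<lambda>h. g y \<bullet> h)) (at y)) \<and> continuous_on U g \<and>
     \<Omega> \<inter> U = {y\<in>U. \<rho> y < (0::real)} \<and> g x \<noteq> 0 \<and> \<nu> = g x /\<^sub>R norm (g x))"

text \<open>
  The \<open>j\<close>-th normal derivative of \<open>u\<close> at a boundary point \<open>x\<close>: derivatives at the boundary are
  the continuous extensions of the interior ones, and \<open>\<nu> = exterior_normal \<Omega> x\<close> is kept fixed
  when differentiating repeatedly.
\<close>

definition has_normal_deriv ::
  "'a::euclidean_space set \<Rightarrow> nat \<Rightarrow> ('a \<Rightarrow> real) \<Rightarrow> real \<Rightarrow> 'a \<Rightarrow> bool" where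
  "has_normal_deriv \<Omega> j u l x \<longleftrightarrow>
     ((dir_deriv (exterior_normal \<Omega> x) ^^ j) u \<longlongrightarrow> l) (at x within \<Omega>)"

definition dirichlet_solution ::
  "nat \<Rightarrow> real \<Rightarrow> 'a::euclidean_space set \<Rightarrow> ('a \<Rightarrow> real) \<Rightarrow> ('a \<Rightarrow> real) \<Rightarrow> bool" where
  "dirichlet_solution k \<theta> \<Omega> f u \<longleftrightarrow>
     u \<in> holder_closure (2 * k) \<theta> \<Omega> \<and>
     (\<forall>x\<in>\<Omega>. polyharmonic k u x = f x) \<and>
     (\<forall>x\<in>frontier \<Omega>. \<forall>j<k. has_normal_deriv \<Omega> j u 0 x)"

text \<open>
  \<open>G\<close> is the Green function of \<open>\<Omega>\<close>; only its values at off-diagonal pairs of points of the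
  closure matter. Uniqueness of the solution \<open>u\<close> is part of the representation clause.
\<close>

definition is_green_function ::
  "nat \<Rightarrow> real \<Rightarrow> 'a::euclidean_space set \<Rightarrow> ('a \<times> 'a \<Rightarrow> real) \<Rightarrow> bool" where
  "is_green_function k \<theta> \<Omega> G \<longleftrightarrow>
     continuous_on (closure \<Omega> \<times> closure \<Omega> - {(x, x) |x. x \<in> closure \<Omega>}) G \<and>
     (\<forall>f\<in>holder_closure 0 \<theta> \<Omega>.
        (\<exists>u. dirichlet_solution k \<theta> \<Omega> f u) \<and>
        (\<forall>u. dirichlet_solution k \<theta> \<Omega> f u \<longrightarrow>
           (\<forall>x\<in>closure \<Omega>. set_integrable lebesgue \<Omega> (\<lambda>y. G (x, y) * f y) \<and>
              u x = (LINT y:\<Omega>|lebesgue. G (x, y) * f y))))"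

definition negative_part :: "('b \<Rightarrow> real) \<Rightarrow> 'b \<Rightarrow> real" where
  "negative_part g = (\<lambda>z. max (- g z) 0)"

definition Linf_norm :: "'b measure \<Rightarrow> ('b \<Rightarrow> real) \<Rightarrow> ereal" where
  "Linf_norm M g = esssup M (\<lambda>z. ereal \<bar>g z\<bar>)"

end

theory Submission
  imports Defs
begin

text \<open>
  The equivalence is a scaling argument. Write \<open>n\<close> for the dimension and, for \<open>c > 0\<close>, let
  \<open>dilate c \<Omega>\<close> be the set of all \<open>x\<close> with \<open>c *\<^sub>R x \<in> \<Omega>\<close>. If \<open>u\<close> solves the Dirichlet problem on \<open>\<Omega>\<close>
  with right-hand side \<open>f\<close>, then \<open>x \<mapsto> u (c *\<^sub>R x)\<close> solves it on \<open>dilate c \<Omega>\<close> with right-hand side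
  \<open>x \<mapsto> c ^ (2 * k) * f (c *\<^sub>R x)\<close>, and the substitution \<open>y = c *\<^sub>R z\<close> in the representation formula
  contributes a Jacobian \<open>c ^ n\<close>. Hence a Green function \<open>G\<close> of \<open>\<Omega>\<close> gives the Green function
  \<open>c ^ n / c ^ (2 * k) * G (c *\<^sub>R x, c *\<^sub>R y)\<close> of \<open>dilate c \<Omega>\<close> (\<open>is_green_function_rescale\<close>), and the
  dilated domain is as smooth as the original one (\<open>holder_smooth_bounded_domain_dilate\<close>).

  Suppose that the negative parts of all Green functions are bounded by one constant \<open>C\<close>. Off the
  diagonal Green functions are continuous, so the essential bound holds at every off-diagonal
  point of \<open>\<Omega> \<times> \<Omega>\<close> (\<open>pointwise_lower_bound_of_Linf_norm\<close>). Applied to all dilations it says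
  \<open>- C \<le> c ^ (n - 2 * k) * G z\<close> for every \<open>c > 0\<close>. As \<open>n > 2 * k\<close>, letting \<open>c\<close> tend to infinity
  excludes \<open>G z < 0\<close>, and continuity carries \<open>G \<ge> 0\<close> to the closure. The converse holds with
  \<open>C = 0\<close>, because the diagonal, where \<open>G\<close> is arbitrary, is a null set.
\<close>


section \<open>Calculus of iterated directional derivatives\<close>

text \<open>
  \<^const>\<open>frechet_derivative\<close> picks an arbitrary value where no derivative exists, but the choice
  depends only on which maps are derivatives, hence only on the germ of the function. The
  congruence rules therefore hold at all points, differentiable or not. They allow the
  derivative of a rescaled function to be replaced by the rescaled derivative, with which it
  agrees on the open set only.
\<close>

lemma frechet_derivative_cong_open:
  assumes "open S" "x \<in> S" "\<And>y. y \<in> S \<Longrightarrow> f y = g y"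
  shows "frechet_derivative f (at x) = frechet_derivative g (at x)"
proof -
  have "(f has_derivative D) (at x) \<longleftrightarrow> (g has_derivative D) (at x)" for D
    using assms by (metis has_derivative_transform_within_open)
  then show ?thesis by (simp add: frechet_derivative_def)
qed

lemma dir_deriv_cong_open:
  assumes "open S" "x \<in> S" "\<And>y. y \<in> S \<Longrightarrow> f y = g y"
  shows "dir_deriv v f x = dir_deriv v g x"
  unfolding dir_deriv_def by (simp add: frechet_derivative_cong_open[OF assms])

lemma foldr_dir_deriv_cong_open:
  assumes "open S" "\<And>y. y \<in> S \<Longrightarrow> f y = g y" "x \<in> S"
  shows "foldr dir_deriv vs f x = foldr dir_deriv vs g x"
  using assms(3)
proof (induction vs arbitrary: x)
  case (Cons v vs)
  show ?case
    using dir_deriv_cong_open[OF \<open>open S\<close> Cons.prems Cons.IH] by simp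
qed (simp add: assms)

lemma laplacian_cong_open:
  assumes "open S" "x \<in> S" "\<And>y. y \<in> S \<Longrightarrow> f y = g y"
  shows "laplacian f x = laplacian g x"
  unfolding laplacian_def
  using foldr_dir_deriv_cong_open[OF assms(1,3,2), where vs = "[b, b]" for b] by simp

lemma polyharmonic_Suc: "polyharmonic (Suc k) f = polyharmonic k (\<lambda>x. - laplacian f x)"
  unfolding polyharmonic_def by (simp only: funpow_Suc_right o_apply)

lemma polyharmonic_cong_open:
  assumes "open S" "x \<in> S" "\<And>y. y \<in> S \<Longrightarrow> f y = g y"
  shows "polyharmonic k f x = polyharmonic k g x"
  using assms(2,3)
proof (induction k arbitrary: f g)
  case 0
  then show ?case by (simp add: polyharmonic_def)
next
  case (Suc k)
  have "- laplacian f y = - laplacian g y" if "y \<in> S" for y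
    using laplacian_cong_open[OF \<open>open S\<close> that Suc.prems(2)] by simp
  from Suc.IH[OF Suc.prems(1) this] show ?case
    by (simp only: polyharmonic_Suc)
qed

lemma differentiable_cong_open:
  assumes "open S" "x \<in> S" "\<And>y. y \<in> S \<Longrightarrow> f y = g y"
  shows "f differentiable (at x) \<longleftrightarrow> g differentiable (at x)"
  unfolding differentiable_def using assms by (metis has_derivative_transform_within_open)

lemma C_diff_cong_open:
  assumes "open S" "\<And>y. y \<in> S \<Longrightarrow> f y = g y"
  shows "C_diff m S f \<longleftrightarrow> C_diff m S g"
  using assms(2)
proof (induction m arbitrary: f g)
  case 0
  then show ?case by (auto cong: continuous_on_cong)
next
  case (Suc m)
  have "C_diff m S (dir_deriv b f) \<longleftrightarrow> C_diff m S (dir_deriv b g)" for b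
    by (rule Suc.IH) (rule dir_deriv_cong_open[OF \<open>open S\<close> _ Suc.prems])
  moreover have "f differentiable (at x) \<longleftrightarrow> g differentiable (at x)" if "x \<in> S" for x
    using differentiable_cong_open[OF \<open>open S\<close> that] Suc.prems by blast
  ultimately show ?case by simp
qed

lemma dir_deriv_cmult_add:
  assumes "f differentiable (at x)" "g differentiable (at x)"
  shows "dir_deriv v (\<lambda>x. a * f x + g x) x = a * dir_deriv v f x + dir_deriv v g x"
proof -
  have "((\<lambda>x. a * f x + g x) has_derivative
      (\<lambda>h. a * frechet_derivative f (at x) h + frechet_derivative g (at x) h)) (at x)"
    using assms unfolding frechet_derivative_works by (intro derivative_intros)
  from frechet_derivative_at[OF this] show ?thesis
    unfolding dir_deriv_def by metis
qed

lemma C_diff_cmult_add: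
  assumes "open S" "C_diff m S f" "C_diff m S g"
  shows "C_diff m S (\<lambda>x. a * f x + g x)"
  using assms(2,3)
proof (induction m arbitrary: f g)
  case 0
  then show ?case by (auto intro!: continuous_intros)
next
  case (Suc m)
  have "C_diff m S (dir_deriv b (\<lambda>x. a * f x + g x))" if "b \<in> Basis" for b
  proof -
    have "C_diff m S (\<lambda>x. a * dir_deriv b f x + dir_deriv b g x)"
      using Suc that by simp
    then show ?thesis
      by (rule C_diff_cong_open[THEN iffD1, OF \<open>open S\<close>, rotated])
        (use Suc.prems in \<open>simp add: dir_deriv_cmult_add\<close>)
  qed
  then show ?case using Suc.prems by (auto intro!: derivative_intros)
qed

lemma C_diff_zero: "open S \<Longrightarrow> C_diff m S (\<lambda>x. 0)"
proof (induction m)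
  case (Suc m)
  then show ?case by (simp add: dir_deriv_def)
qed simp

lemma C_diff_sum:
  assumes "open S" "finite B" "\<And>b. b \<in> B \<Longrightarrow> C_diff m S (F b)"
  shows "C_diff m S (\<lambda>x. \<Sum>b\<in>B. a b * F b x)"
  using assms(2,3)
  by (induction B rule: finite_induct) (simp_all add: C_diff_zero C_diff_cmult_add \<open>open S\<close>)

lemma dir_deriv_basis_expansion:
  assumes "f differentiable (at x)"
  shows "dir_deriv v f x = (\<Sum>b\<in>Basis. (v \<bullet> b) * dir_deriv b f x)"
proof -
  have lin: "linear (frechet_derivative f (at x))"
    using assms by (rule linear_frechet_derivative)
  have "frechet_derivative f (at x) v = frechet_derivative f (at x) (\<Sum>b\<in>Basis. (v \<bullet> b) *\<^sub>R b)"
    by (simp add: euclidean_representation)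
  then show ?thesis
    by (simp add: dir_deriv_def linear_sum[OF lin] linear_cmul[OF lin])
qed

text \<open>
  \<^const>\<open>C_diff\<close> speaks of coordinate directions only, while normal derivatives differentiate
  in an arbitrary direction; linearity of the derivative bridges the two.
\<close>

lemma C_diff_dir_deriv:
  assumes "open S" "C_diff (Suc m) S f"
  shows "C_diff m S (dir_deriv v f)"
proof -
  have "C_diff m S (\<lambda>x. \<Sum>b\<in>Basis. (v \<bullet> b) * dir_deriv b f x)"
    using assms by (intro C_diff_sum) auto
  then show ?thesis
    by (rule C_diff_cong_open[THEN iffD1, OF \<open>open S\<close>, rotated])
      (use assms in \<open>simp add: dir_deriv_basis_expansion\<close>)
qed

lemma C_diff_laplacian:
  assumes "open S" "C_diff (Suc (Suc m)) S f"
  shows "C_diff m S (laplacian f)"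
  using C_diff_sum[OF assms(1) finite_Basis, of m "\<lambda>b. dir_deriv b (dir_deriv b f)" "\<lambda>_. 1"]
    assms(2) by (simp add: laplacian_def)


section \<open>Derivatives under rescaling\<close>

text \<open>
  Defined as a preimage, so that \<open>x \<mapsto> f (c *\<^sub>R x)\<close> on \<open>dilate c S\<close> corresponds to \<open>f\<close> on \<open>S\<close>
  and no inverse of \<open>c\<close> enters the derivative formulas.
\<close>

definition dilate :: "real \<Rightarrow> 'a::real_normed_vector set \<Rightarrow> 'a set" where
  "dilate c S = {x. c *\<^sub>R x \<in> S}"

lemma mem_dilate [simp]: "x \<in> dilate c S \<longleftrightarrow> c *\<^sub>R x \<in> S"
  by (simp add: dilate_def)

lemma dilate_dilate_inverse: "c > 0 \<Longrightarrow> dilate (1 / c) (dilate c S) = S"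
  by (auto simp: dilate_def)

lemma dilate_eq_image: "c > 0 \<Longrightarrow> dilate c S = (*\<^sub>R) (1 / c) ` S"
  by (force simp: dilate_def image_iff)

lemma open_dilate: "open S \<Longrightarrow> open (dilate c S)"
  using open_vimage[OF _ continuous_on_scaleR[OF continuous_on_const continuous_on_id], of S c]
  by (simp add: dilate_def vimage_def)

lemma closure_dilate: "c > 0 \<Longrightarrow> closure (dilate c S) = dilate c (closure S)"
  by (simp add: dilate_eq_image closure_scaleR)

lemma interior_dilate:
  fixes S :: "'a::euclidean_space set"
  assumes "c > 0"
  shows "interior (dilate c S) = dilate c (interior S)"
proof -
  have "linear ((*\<^sub>R) (1 / c) :: 'a \<Rightarrow> 'a)" "inj ((*\<^sub>R) (1 / c) :: 'a \<Rightarrow> 'a)"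
    using assms by (auto intro: linear_scale_self injI)
  then show ?thesis
    using assms by (simp add: dilate_eq_image interior_injective_linear_image)
qed

lemma frontier_dilate:
  fixes S :: "'a::euclidean_space set"
  shows "c > 0 \<Longrightarrow> frontier (dilate c S) = dilate c (frontier S)"
  by (auto simp: frontier_def closure_dilate interior_dilate)

lemma continuous_on_rescale:
  fixes f :: "'a::real_normed_vector \<Rightarrow> real"
  assumes "continuous_on S f"
  shows "continuous_on (dilate c S) (\<lambda>x. a * f (c *\<^sub>R x))"
proof -
  have "continuous_on (dilate c S) (f \<circ> (*\<^sub>R) c)"
    by (rule continuous_on_compose)
      (use assms in \<open>auto intro!: continuous_intros elim: continuous_on_subset\<close>)
  then show ?thesis by (auto simp: o_def intro!: continuous_intros)
qed

lemma differentiable_rescale: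
  fixes f :: "'a::real_normed_vector \<Rightarrow> real"
  assumes "f differentiable (at (c *\<^sub>R x))"
  shows "(\<lambda>x. a * f (c *\<^sub>R x)) differentiable (at x)"
proof -
  obtain D where "(f has_derivative D) (at (c *\<^sub>R x))"
    using assms by (auto simp: differentiable_def)
  then have "((\<lambda>x. a * f (c *\<^sub>R x)) has_derivative (\<lambda>h. a * D (c *\<^sub>R h))) (at x)"
    by (intro derivative_intros has_derivative_compose[where f = "(*\<^sub>R) c", unfolded o_def])
  then show ?thesis by (auto simp: differentiable_def)
qed

text \<open>
  Differentiability matters: at a point where it fails, the formula compares arbitrary default
  derivatives and may be wrong. This is why the iterated
  rules below count derivatives against the smoothness order.
\<close>

lemma dir_deriv_rescale:
  assumes "f differentiable (at (c *\<^sub>R x))"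
  shows "dir_deriv v (\<lambda>x. a * f (c *\<^sub>R x)) x = a * c * dir_deriv v f (c *\<^sub>R x)"
proof -
  let ?D = "frechet_derivative f (at (c *\<^sub>R x))"
  have D: "(f has_derivative ?D) (at (c *\<^sub>R x))"
    using assms by (simp add: frechet_derivative_works)
  then have "((\<lambda>x. a * f (c *\<^sub>R x)) has_derivative (\<lambda>h. a * ?D (c *\<^sub>R h))) (at x)"
    by (intro derivative_intros has_derivative_compose[where f = "(*\<^sub>R) c", unfolded o_def])
  from frechet_derivative_at[OF this] show ?thesis
    unfolding dir_deriv_def
    by (metis D has_derivative_linear linear_cmul mult.assoc real_scaleR_def)
qed

lemma C_diff_rescale:
  assumes "open S" "C_diff m S f"
  shows "C_diff m (dilate c S) (\<lambda>x. a * f (c *\<^sub>R x))"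
  using assms(2)
proof (induction m arbitrary: f a)
  case 0
  then show ?case by (simp add: continuous_on_rescale)
next
  case (Suc m)
  have "C_diff m (dilate c S) (dir_deriv b (\<lambda>x. a * f (c *\<^sub>R x)))" if "b \<in> Basis" for b
  proof -
    have "C_diff m (dilate c S) (\<lambda>x. (a * c) * dir_deriv b f (c *\<^sub>R x))"
      using Suc that by simp
    then show ?thesis
      by (rule C_diff_cong_open[THEN iffD1, OF open_dilate[OF \<open>open S\<close>], rotated])
        (use Suc.prems in \<open>simp add: dir_deriv_rescale\<close>)
  qed
  moreover have "(\<lambda>x. a * f (c *\<^sub>R x)) differentiable (at x)" if "x \<in> dilate c S" for x
    using Suc.prems that by (intro differentiable_rescale) simp
  ultimately show ?case by simp
qed

text \<open>
  The directions are arbitrary, so the rule covers both the partial derivatives in the Hoelder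
  spaces and the iterated normal derivatives in the boundary condition. The induction peels off
  the innermost derivative, the last list entry, since that is the one the smoothness order
  of \<open>f\<close> speaks about.
\<close>

lemma foldr_dir_deriv_rescale:
  assumes "open S" "C_diff m S f" "length vs \<le> m" "x \<in> dilate c S"
  shows "foldr dir_deriv vs (\<lambda>x. a * f (c *\<^sub>R x)) x
       = a * c ^ length vs * foldr dir_deriv vs f (c *\<^sub>R x)"
  using assms(2,3)
proof (induction vs arbitrary: m f a rule: rev_induct)
  case (snoc v vs)
  then obtain m' where m: "m = Suc m'" "length vs \<le> m'"
    by (cases m) auto
  have "foldr dir_deriv vs (dir_deriv v (\<lambda>x. a * f (c *\<^sub>R x))) x
      = foldr dir_deriv vs (\<lambda>x. (a * c) * dir_deriv v f (c *\<^sub>R x)) x"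
    by (rule foldr_dir_deriv_cong_open[OF open_dilate[OF \<open>open S\<close>] _ \<open>x \<in> dilate c S\<close>])
      (use snoc.prems m in \<open>simp add: dir_deriv_rescale\<close>)
  also have "\<dots> = (a * c) * c ^ length vs * foldr dir_deriv vs (dir_deriv v f) (c *\<^sub>R x)"
    using snoc.prems m by (intro snoc.IH[of m'] C_diff_dir_deriv[OF \<open>open S\<close>]) auto
  finally show ?case by (simp add: mult_ac)
qed simp

lemma polyharmonic_rescale:
  assumes "open S" "C_diff (2 * k) S f" "x \<in> dilate c S"
  shows "polyharmonic k (\<lambda>x. a * f (c *\<^sub>R x)) x
       = a * c ^ (2 * k) * polyharmonic k f (c *\<^sub>R x)"
  using assms(2)
proof (induction k arbitrary: f a)
  case 0
  then show ?case by (simp add: polyharmonic_def)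
next
  case (Suc k)
  have lap: "- laplacian (\<lambda>x. a * f (c *\<^sub>R x)) y = (a * c\<^sup>2) * - laplacian f (c *\<^sub>R y)"
    if "y \<in> dilate c S" for y
  proof -
    have "dir_deriv b (dir_deriv b (\<lambda>x. a * f (c *\<^sub>R x))) y
        = a * c\<^sup>2 * dir_deriv b (dir_deriv b f) (c *\<^sub>R y)" for b
      using foldr_dir_deriv_rescale[OF \<open>open S\<close> Suc.prems, of "[b, b]" y c a] that
      by (simp add: power2_eq_square)
    then show ?thesis by (simp add: laplacian_def sum_distrib_left)
  qed
  have "C_diff (2 * k) S (laplacian f)"
    using Suc.prems by (intro C_diff_laplacian[OF \<open>open S\<close>]) simp
  from C_diff_cmult_add[OF \<open>open S\<close> this C_diff_zero[OF \<open>open S\<close>], of "-1"]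
  have C: "C_diff (2 * k) S (\<lambda>x. - laplacian f x)" by simp
  have "polyharmonic k (\<lambda>x. - laplacian (\<lambda>x. a * f (c *\<^sub>R x)) x) x
      = polyharmonic k (\<lambda>x. (a * c\<^sup>2) * - laplacian f (c *\<^sub>R x)) x"
    by (rule polyharmonic_cong_open[OF open_dilate[OF \<open>open S\<close>] \<open>x \<in> dilate c S\<close>]) (rule lap)
  also have "\<dots> = (a * c\<^sup>2) * c ^ (2 * k) * polyharmonic k (\<lambda>x. - laplacian f x) (c *\<^sub>R x)"
    by (rule Suc.IH[OF C])
  finally show ?case
    by (simp add: polyharmonic_Suc power2_eq_square)
qed


section \<open>Rescaling Hoelder spaces and smooth domains\<close>

text \<open>
  The Hoelder constant picks up the factor \<open>c powr \<theta>\<close> from the distances besides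
  \<open>\<bar>a * c ^ m\<bar>\<close> from the derivatives. The amplitude \<open>a\<close> serves the right-hand sides of the
  Dirichlet problem and, with \<open>c = 1\<close>, the inverse boundary charts.
\<close>

lemma holder_closure_rescale:
  assumes "open S" "c > 0" "f \<in> holder_closure m \<theta> S"
  shows "(\<lambda>x. a * f (c *\<^sub>R x)) \<in> holder_closure m \<theta> (dilate c S)"
proof -
  let ?f = "\<lambda>x. a * f (c *\<^sub>R x)"
  have C: "C_diff m S f" and cont: "continuous_on (closure S) f"
    and ext: "\<And>bs. set bs \<subseteq> Basis \<Longrightarrow> length bs \<le> m \<Longrightarrow>
        \<exists>g. continuous_on (closure S) g \<and> (\<forall>x\<in>S. g x = foldr dir_deriv bs f x)"
    and hol: "\<And>bs. set bs \<subseteq> Basis \<Longrightarrow> length bs = m \<Longrightarrow> \<exists>L. \<forall>x\<in>S. \<forall>y\<in>S.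
        \<bar>foldr dir_deriv bs f x - foldr dir_deriv bs f y\<bar> \<le> L * dist x y powr \<theta>"
    using assms(3) unfolding holder_closure_def by blast+
  note scale = foldr_dir_deriv_rescale[OF \<open>open S\<close> C]
  have "\<exists>g. continuous_on (closure (dilate c S)) g \<and>
      (\<forall>x\<in>dilate c S. g x = foldr dir_deriv bs ?f x)"
    if bs: "set bs \<subseteq> Basis" "length bs \<le> m" for bs
  proof -
    obtain g where "continuous_on (closure S) g" "\<forall>x\<in>S. g x = foldr dir_deriv bs f x"
      using ext[OF bs] by blast
    then show ?thesis
      by (intro exI[of _ "\<lambda>x. (a * c ^ length bs) * g (c *\<^sub>R x)"])
        (simp add: closure_dilate[OF \<open>c > 0\<close>] continuous_on_rescale scale[OF bs(2)])
  qed
  moreover have "\<exists>L. \<forall>x\<in>dilate c S. \<forall>y\<in>dilate c S.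
      \<bar>foldr dir_deriv bs ?f x - foldr dir_deriv bs ?f y\<bar> \<le> L * dist x y powr \<theta>"
    if bs: "set bs \<subseteq> Basis" "length bs = m" for bs
  proof -
    obtain L where L: "\<And>x y. x \<in> S \<Longrightarrow> y \<in> S \<Longrightarrow>
        \<bar>foldr dir_deriv bs f x - foldr dir_deriv bs f y\<bar> \<le> L * dist x y powr \<theta>"
      using hol[OF bs] by blast
    have "\<bar>foldr dir_deriv bs ?f x - foldr dir_deriv bs ?f y\<bar>
        \<le> (\<bar>a * c ^ m\<bar> * L * c powr \<theta>) * dist x y powr \<theta>"
      if xy: "x \<in> dilate c S" "y \<in> dilate c S" for x y
    proof -
      have "\<bar>foldr dir_deriv bs ?f x - foldr dir_deriv bs ?f y\<bar>
          = \<bar>a * c ^ m\<bar> * \<bar>foldr dir_deriv bs f (c *\<^sub>R x) - foldr dir_deriv bs f (c *\<^sub>R y)\<bar>"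
        using scale[of bs] bs xy by (simp add: abs_mult right_diff_distrib flip: abs_mult)
      also have "\<dots> \<le> \<bar>a * c ^ m\<bar> * (L * dist (c *\<^sub>R x) (c *\<^sub>R y) powr \<theta>)"
        using xy by (intro mult_left_mono L) auto
      also have "dist (c *\<^sub>R x) (c *\<^sub>R y) = c * dist x y"
        using \<open>c > 0\<close> by (simp add: dist_norm flip: scaleR_diff_right)
      finally show ?thesis
        using \<open>c > 0\<close> by (simp add: powr_mult mult_ac)
    qed
    then show ?thesis by blast
  qed
  ultimately show ?thesis
    unfolding holder_closure_def
    using C_diff_rescale[OF \<open>open S\<close> C] continuous_on_rescale[OF cont]
    by (auto simp: closure_dilate[OF \<open>c > 0\<close>])
qed

definition has_flattening_chart ::
  "nat \<Rightarrow> real \<Rightarrow> 'a::euclidean_space set \<Rightarrow> 'a \<Rightarrow> bool" where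
  "has_flattening_chart m \<theta> \<Omega> x \<longleftrightarrow> (\<exists>V W (\<psi> :: 'a \<Rightarrow> 'a) \<phi>. \<exists>e\<in>Basis.
        open V \<and> x \<in> V \<and> open W \<and> homeomorphism V W \<psi> \<phi> \<and>
        (\<forall>b\<in>Basis. (\<lambda>y. \<psi> y \<bullet> b) \<in> holder_closure m \<theta> V) \<and>
        (\<forall>b\<in>Basis. (\<lambda>z. \<phi> z \<bullet> b) \<in> holder_closure m \<theta> W) \<and>
        \<psi> ` (V \<inter> \<Omega>) = {z\<in>W. z \<bullet> e > 0} \<and>
        \<psi> ` (V \<inter> frontier \<Omega>) = {z\<in>W. z \<bullet> e = 0})"

lemma holder_smooth_bounded_domain_iff:
  "holder_smooth_bounded_domain m \<theta> \<Omega> \<longleftrightarrow>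
     open \<Omega> \<and> connected \<Omega> \<and> \<Omega> \<noteq> {} \<and> bounded \<Omega> \<and>
     (\<forall>x\<in>frontier \<Omega>. has_flattening_chart m \<theta> \<Omega> x)"
  unfolding holder_smooth_bounded_domain_def has_flattening_chart_def by (rule refl)

text \<open>
  Composing the flattening map \<open>\<psi>\<close> with the dilation keeps its image \<open>W\<close>, and with it the two
  half-space conditions; the inverse map is \<open>\<phi>\<close> divided by \<open>c\<close>.
\<close>

lemma has_flattening_chart_dilate:
  fixes \<Omega> :: "'a::euclidean_space set"
  assumes "has_flattening_chart m \<theta> \<Omega> (c *\<^sub>R x)" and c: "c > 0"
  shows "has_flattening_chart m \<theta> (dilate c \<Omega>) x"
proof -
  obtain V W e and \<psi> \<phi> :: "'a \<Rightarrow> 'a" where e: "e \<in> Basis"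
    and VW: "open V" "c *\<^sub>R x \<in> V" "open W" and hom: "homeomorphism V W \<psi> \<phi>"
    and \<psi>: "\<forall>b\<in>Basis. (\<lambda>y. \<psi> y \<bullet> b) \<in> holder_closure m \<theta> V"
    and \<phi>: "\<forall>b\<in>Basis. (\<lambda>z. \<phi> z \<bullet> b) \<in> holder_closure m \<theta> W"
    and half: "\<psi> ` (V \<inter> \<Omega>) = {z\<in>W. z \<bullet> e > 0}"
      "\<psi> ` (V \<inter> frontier \<Omega>) = {z\<in>W. z \<bullet> e = 0}"
    using assms(1) unfolding has_flattening_chart_def
    by (elim exE bexE conjE) (rule that)
  let ?\<psi> = "\<lambda>y. \<psi> (c *\<^sub>R y)" and ?\<phi> = "\<lambda>z. (1 / c) *\<^sub>R \<phi> z"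
  have image: "?\<psi> ` (dilate c V \<inter> dilate c T) = \<psi> ` (V \<inter> T)" for T
  proof -
    have "(*\<^sub>R) c ` dilate c (V \<inter> T) = V \<inter> T"
      using c by (simp add: dilate_eq_image image_image)
    moreover have "dilate c V \<inter> dilate c T = dilate c (V \<inter> T)"
      by auto
    ultimately show ?thesis by (metis image_image)
  qed
  have V_image: "\<psi> ` V = W" and W_image: "\<phi> ` W = V"
    and inv: "\<And>y. y \<in> V \<Longrightarrow> \<phi> (\<psi> y) = y" "\<And>z. z \<in> W \<Longrightarrow> \<psi> (\<phi> z) = z"
    and cont: "continuous_on V \<psi>" "continuous_on W \<phi>"
    using hom by (auto simp: homeomorphism_def)
  have "homeomorphism (dilate c V) W ?\<psi> ?\<phi>"
  proof (rule homeomorphismI)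
    show "continuous_on W ?\<phi>"
      by (intro continuous_intros cont)
    show "continuous_on (dilate c V) ?\<psi>"
      by (rule continuous_on_compose2[OF cont(1)]) (auto intro!: continuous_intros)
    show "?\<psi> ` dilate c V \<subseteq> W" "?\<phi> ` W \<subseteq> dilate c V"
      using V_image W_image c by auto
  qed (use inv c in auto)
  moreover have "\<forall>b\<in>Basis. (\<lambda>y. ?\<psi> y \<bullet> b) \<in> holder_closure m \<theta> (dilate c V)"
  proof
    fix b :: 'a assume "b \<in> Basis"
    with \<psi> have "(\<lambda>y. \<psi> y \<bullet> b) \<in> holder_closure m \<theta> V" by blast
    from holder_closure_rescale[OF VW(1) c this, of 1]
    show "(\<lambda>y. ?\<psi> y \<bullet> b) \<in> holder_closure m \<theta> (dilate c V)" by simp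
  qed
  moreover have "\<forall>b\<in>Basis. (\<lambda>z. ?\<phi> z \<bullet> b) \<in> holder_closure m \<theta> W"
  proof
    fix b :: 'a assume "b \<in> Basis"
    with \<phi> have "(\<lambda>z. \<phi> z \<bullet> b) \<in> holder_closure m \<theta> W" by blast
    from holder_closure_rescale[OF VW(3) _ this, of 1 "1 / c"]
    show "(\<lambda>z. ?\<phi> z \<bullet> b) \<in> holder_closure m \<theta> W" by (simp add: dilate_def)
  qed
  moreover have "open (dilate c V)" "x \<in> dilate c V"
    using VW by (auto intro: open_dilate)
  moreover have "?\<psi> ` (dilate c V \<inter> dilate c \<Omega>) = {z\<in>W. z \<bullet> e > 0}"
    "?\<psi> ` (dilate c V \<inter> frontier (dilate c \<Omega>)) = {z\<in>W. z \<bullet> e = 0}"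
    unfolding frontier_dilate[OF c] image by (fact half)+
  ultimately show ?thesis
    unfolding has_flattening_chart_def using e VW(3)
    by (intro exI[of _ "dilate c V"] exI[of _ W] exI[of _ ?\<psi>] exI[of _ ?\<phi>] bexI[OF _ e] conjI)
qed

lemma holder_smooth_bounded_domain_dilate:
  fixes \<Omega> :: "'a::euclidean_space set"
  assumes dom: "holder_smooth_bounded_domain m \<theta> \<Omega>" and c: "c > 0"
  shows "holder_smooth_bounded_domain m \<theta> (dilate c \<Omega>)"
proof -
  have \<Omega>: "open \<Omega>" "connected \<Omega>" "\<Omega> \<noteq> {}" "bounded \<Omega>"
    and chart: "\<And>x. x \<in> frontier \<Omega> \<Longrightarrow> has_flattening_chart m \<theta> \<Omega> x"
    using dom by (auto simp: holder_smooth_bounded_domain_iff)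
  have "connected (dilate c \<Omega>)" "dilate c \<Omega> \<noteq> {}" "bounded (dilate c \<Omega>)"
    using \<Omega> unfolding dilate_eq_image[OF c]
    by (auto intro!: connected_continuous_image continuous_intros bounded_scaling)
  then show ?thesis
    using open_dilate[OF \<Omega>(1)] has_flattening_chart_dilate[OF chart c]
    by (simp add: holder_smooth_bounded_domain_iff frontier_dilate[OF c])
qed


section \<open>Rescaling the Dirichlet problem\<close>

text \<open>
  The property that \<^const>\<open>exterior_normal\<close> selects by a definite description. Showing that
  the whole property is invariant under dilations makes both descriptions denote the same vector.
\<close>

definition exterior_normal_via_gradient :: "'a::euclidean_space set \<Rightarrow> 'a \<Rightarrow> 'a \<Rightarrow> bool" where
  "exterior_normal_via_gradient \<Omega> x \<nu> \<longleftrightarrow> (\<exists>U \<rho> g. open U \<and> x \<in> U \<and>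
     (\<forall>y\<in>U. (\<rho> has_derivative (\<lambda>h. g y \<bullet> h)) (at y)) \<and> continuous_on U g \<and>
     \<Omega> \<inter> U = {y\<in>U. \<rho> y < (0::real)} \<and> g x \<noteq> 0 \<and> \<nu> = g x /\<^sub>R norm (g x))"

lemma exterior_normal_eq:
  "exterior_normal \<Omega> x = (THE \<nu>. exterior_normal_via_gradient \<Omega> x \<nu>)"
  unfolding exterior_normal_def exterior_normal_via_gradient_def by (rule refl)

text \<open>
  The gradient of the rescaled defining function is multiplied by \<open>c > 0\<close>, which normalisation
  removes.
\<close>

lemma exterior_normal_via_gradient_dilate:
  assumes "exterior_normal_via_gradient \<Omega> (c *\<^sub>R x) \<nu>" "c > 0"
  shows "exterior_normal_via_gradient (dilate c \<Omega>) x \<nu>"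
proof -
  obtain U \<rho> g where U: "open U" "c *\<^sub>R x \<in> U"
    and \<rho>: "\<And>y. y \<in> U \<Longrightarrow> (\<rho> has_derivative (\<lambda>h. g y \<bullet> h)) (at y)"
    and g: "continuous_on U g" "g (c *\<^sub>R x) \<noteq> 0" "\<nu> = g (c *\<^sub>R x) /\<^sub>R norm (g (c *\<^sub>R x))"
    and \<Omega>: "\<Omega> \<inter> U = {y\<in>U. \<rho> y < (0::real)}"
    using assms(1) unfolding exterior_normal_via_gradient_def by blast
  let ?\<rho> = "\<lambda>y. \<rho> (c *\<^sub>R y)" and ?g = "\<lambda>y. c *\<^sub>R g (c *\<^sub>R y)"
  have "(?\<rho> has_derivative (\<lambda>h. ?g y \<bullet> h)) (at y)" if "y \<in> dilate c U" for y
  proof -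
    have "(?\<rho> has_derivative (\<lambda>h. g (c *\<^sub>R y) \<bullet> (c *\<^sub>R h))) (at y)"
      by (rule has_derivative_compose[OF _ \<rho>]) (use that in \<open>auto intro!: derivative_intros\<close>)
    then show ?thesis by simp
  qed
  moreover have "continuous_on (dilate c U) ?g"
    by (intro continuous_intros continuous_on_compose2[OF g(1)]) auto
  moreover have "dilate c \<Omega> \<inter> dilate c U = {y \<in> dilate c U. ?\<rho> y < 0}"
  proof (rule set_eqI)
    show "y \<in> dilate c \<Omega> \<inter> dilate c U \<longleftrightarrow> y \<in> {y \<in> dilate c U. ?\<rho> y < 0}" for y
      using \<Omega>[THEN eqset_imp_iff, of "c *\<^sub>R y"] by simp
  qed
  moreover have "\<nu> = ?g x /\<^sub>R norm (?g x)"
    unfolding g(3) using \<open>c > 0\<close> by simp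
  moreover have "open (dilate c U)" "x \<in> dilate c U" "?g x \<noteq> 0"
    using U g(2) \<open>c > 0\<close> by (simp_all add: open_dilate)
  ultimately show ?thesis
    unfolding exterior_normal_via_gradient_def
    by (intro exI[of _ "dilate c U"] exI[of _ ?\<rho>] exI[of _ ?g] conjI ballI)
qed

lemma exterior_normal_dilate:
  assumes "c > 0"
  shows "exterior_normal (dilate c \<Omega>) x = exterior_normal \<Omega> (c *\<^sub>R x)"
proof -
  have "exterior_normal_via_gradient (dilate c \<Omega>) x \<nu>
      \<longleftrightarrow> exterior_normal_via_gradient \<Omega> (c *\<^sub>R x) \<nu>" for \<nu>
  proof
    assume "exterior_normal_via_gradient (dilate c \<Omega>) x \<nu>"
    then have "exterior_normal_via_gradient (dilate c \<Omega>) ((1 / c) *\<^sub>R (c *\<^sub>R x)) \<nu>"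
      using assms by simp
    then have "exterior_normal_via_gradient (dilate (1 / c) (dilate c \<Omega>)) (c *\<^sub>R x) \<nu>"
      by (rule exterior_normal_via_gradient_dilate) (use assms in simp)
    then show "exterior_normal_via_gradient \<Omega> (c *\<^sub>R x) \<nu>"
      by (simp only: dilate_dilate_inverse[OF assms])
  qed (rule exterior_normal_via_gradient_dilate[OF _ assms])
  then show ?thesis
    by (simp only: exterior_normal_eq)
qed

lemma has_normal_deriv_rescale:
  assumes "open \<Omega>" "c > 0" "C_diff m \<Omega> u" "j \<le> m"
    and "has_normal_deriv \<Omega> j u l (c *\<^sub>R x)"
  shows "has_normal_deriv (dilate c \<Omega>) j (\<lambda>x. a * u (c *\<^sub>R x)) (a * c ^ j * l) x"
proof -
  let ?\<nu> = "exterior_normal \<Omega> (c *\<^sub>R x)"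
  let ?D = "foldr dir_deriv (replicate j ?\<nu>)"
  have "(?D u \<longlongrightarrow> l) (at (c *\<^sub>R x) within \<Omega>)"
    using assms(5) by (simp add: has_normal_deriv_def)
  moreover have "filterlim ((*\<^sub>R) c) (at (c *\<^sub>R x) within \<Omega>) (at x within dilate c \<Omega>)"
    unfolding filterlim_at using \<open>c > 0\<close>
    by (auto simp: eventually_at_filter intro!: tendsto_intros)
  ultimately have "((\<lambda>y. ?D u (c *\<^sub>R y)) \<longlongrightarrow> l) (at x within dilate c \<Omega>)"
    by (rule filterlim_compose)
  then have "((\<lambda>y. a * c ^ j * ?D u (c *\<^sub>R y)) \<longlongrightarrow> a * c ^ j * l) (at x within dilate c \<Omega>)"
    by (intro tendsto_intros)
  then have "(?D (\<lambda>x. a * u (c *\<^sub>R x)) \<longlongrightarrow> a * c ^ j * l) (at x within dilate c \<Omega>)"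
    by (rule Lim_transform_eventually)
      (use foldr_dir_deriv_rescale[OF assms(1,3), of "replicate j ?\<nu>"] \<open>j \<le> m\<close> in
        \<open>simp add: eventually_at_filter\<close>)
  then show ?thesis
    by (simp add: has_normal_deriv_def exterior_normal_dilate[OF \<open>c > 0\<close>])
qed

lemma dirichlet_solution_rescale:
  assumes "open \<Omega>" "c > 0" and sol: "dirichlet_solution k \<theta> \<Omega> f u"
  shows "dirichlet_solution k \<theta> (dilate c \<Omega>) (\<lambda>x. c ^ (2 * k) * f (c *\<^sub>R x)) (\<lambda>x. u (c *\<^sub>R x))"
proof -
  have u: "u \<in> holder_closure (2 * k) \<theta> \<Omega>" and eq: "\<And>x. x \<in> \<Omega> \<Longrightarrow> polyharmonic k u x = f x"
    and bd: "\<And>x j. x \<in> frontier \<Omega> \<Longrightarrow> j < k \<Longrightarrow> has_normal_deriv \<Omega> j u 0 x"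
    using sol by (auto simp: dirichlet_solution_def)
  have C: "C_diff (2 * k) \<Omega> u"
    using u by (simp add: holder_closure_def)
  show ?thesis
    unfolding dirichlet_solution_def
  proof (intro conjI ballI allI impI)
    show "(\<lambda>x. u (c *\<^sub>R x)) \<in> holder_closure (2 * k) \<theta> (dilate c \<Omega>)"
      using holder_closure_rescale[OF assms(1,2) u, of 1] by simp
    show "polyharmonic k (\<lambda>x. u (c *\<^sub>R x)) x = c ^ (2 * k) * f (c *\<^sub>R x)"
      if "x \<in> dilate c \<Omega>" for x
      using polyharmonic_rescale[OF assms(1) C that, of 1] eq that by simp
    show "has_normal_deriv (dilate c \<Omega>) j (\<lambda>x. u (c *\<^sub>R x)) 0 x"
      if "x \<in> frontier (dilate c \<Omega>)" "j < k" for x j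
      using has_normal_deriv_rescale[OF assms(1,2) C _ bd, of j x 1] that
      by (simp add: frontier_dilate[OF \<open>c > 0\<close>])
  qed
qed


section \<open>Rescaling the Green function\<close>

text \<open>
  The substitution rule for a dilation, as the case of equal factors of the formula for
  Lebesgue measure under coordinatewise affine maps.
\<close>

lemma
  fixes f :: "'a::euclidean_space \<Rightarrow> real"
  assumes "c > 0" and f: "integrable lebesgue f"
  shows integrable_lebesgue_rescale: "integrable lebesgue (\<lambda>x. f (c *\<^sub>R x))"
    and integral_lebesgue_rescale:
      "(\<integral>x. f x \<partial>lebesgue) = c ^ DIM('a) * (\<integral>x. f (c *\<^sub>R x) \<partial>lebesgue)"
proof -
  have T: "(\<lambda>x::'a. 0 + (\<Sum>j\<in>Basis. (c * (x \<bullet> j)) *\<^sub>R j)) = (*\<^sub>R) c"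
    by (simp add: fun_eq_iff euclidean_representation flip: scaleR_scaleR scaleR_sum_right)
  have meas: "(*\<^sub>R) c \<in> lebesgue \<rightarrow>\<^sub>M (lebesgue :: 'a measure)"
    using lebesgue_affine_measurable[of "\<lambda>_. c" "0::'a"] \<open>c > 0\<close> by (simp only: T)
  have leb: "(lebesgue :: 'a measure)
      = density (distr lebesgue lebesgue ((*\<^sub>R) c)) (\<lambda>_. ennreal (c ^ DIM('a)))"
    using lebesgue_affine_euclidean[of "\<lambda>_. c" "0::'a"] \<open>c > 0\<close>
    by (simp only: T) (simp add: ennreal_power)
  have fm: "f \<in> borel_measurable lebesgue"
    using f by auto
  have "integrable (distr lebesgue lebesgue ((*\<^sub>R) c)) (\<lambda>x. c ^ DIM('a) *\<^sub>R f x)"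
    using f \<open>c > 0\<close> fm by (subst (asm) leb, subst (asm) integrable_density) auto
  then show "integrable lebesgue (\<lambda>x. f (c *\<^sub>R x))"
    using \<open>c > 0\<close> meas fm by (simp add: integrable_distr_eq)
  have "(\<integral>x. f x \<partial>lebesgue)
      = (\<integral>x. c ^ DIM('a) *\<^sub>R f x \<partial>distr lebesgue lebesgue ((*\<^sub>R) c))"
    using \<open>c > 0\<close> fm by (subst leb, subst integral_density) auto
  also have "\<dots> = c ^ DIM('a) * (\<integral>x. f (c *\<^sub>R x) \<partial>lebesgue)"
    using meas fm by (simp add: integral_distr)
  finally show "(\<integral>x. f x \<partial>lebesgue) = c ^ DIM('a) * (\<integral>x. f (c *\<^sub>R x) \<partial>lebesgue)" .
qed

definition rescaled_green :: "nat \<Rightarrow> real \<Rightarrow> ('a::euclidean_space \<times> 'a \<Rightarrow> real) \<Rightarrow> 'a \<times> 'a \<Rightarrow> real"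
  where "rescaled_green k c G = (\<lambda>z. c ^ DIM('a) / c ^ (2 * k) * G (c *\<^sub>R z))"

text \<open>
  Dilating by \<open>1 / c\<close> turns data \<open>f\<close> on \<open>dilate c \<Omega>\<close> into data \<open>f'\<close> on \<open>\<Omega>\<close>. Existence comes
  from dilating a solution for \<open>f'\<close> by \<open>c\<close>. For the representation, an arbitrary solution on
  \<open>dilate c \<Omega>\<close> is dilated by \<open>1 / c\<close>, represented by \<open>G\<close>, and the integral is substituted back.
\<close>

lemma is_green_function_rescale:
  fixes \<Omega> :: "'a::euclidean_space set"
  assumes "open \<Omega>" and c: "c > 0" and G: "is_green_function k \<theta> \<Omega> G"
  shows "is_green_function k \<theta> (dilate c \<Omega>) (rescaled_green k c G)"
  unfolding is_green_function_def
proof (intro conjI ballI allI impI)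
  let ?A = "c ^ DIM('a) / c ^ (2 * k)"
  have contG: "continuous_on (closure \<Omega> \<times> closure \<Omega> - {(x, x) |x. x \<in> closure \<Omega>}) G"
    and ex: "\<And>f. f \<in> holder_closure 0 \<theta> \<Omega> \<Longrightarrow> \<exists>u. dirichlet_solution k \<theta> \<Omega> f u"
    and rep: "\<And>f u x. f \<in> holder_closure 0 \<theta> \<Omega> \<Longrightarrow> dirichlet_solution k \<theta> \<Omega> f u \<Longrightarrow>
        x \<in> closure \<Omega> \<Longrightarrow> set_integrable lebesgue \<Omega> (\<lambda>y. G (x, y) * f y) \<and>
          u x = (LINT y:\<Omega>|lebesgue. G (x, y) * f y)"
    using G unfolding is_green_function_def by blast+
  show "continuous_on (closure (dilate c \<Omega>) \<times> closure (dilate c \<Omega>)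
      - {(x, x) |x. x \<in> closure (dilate c \<Omega>)}) (rescaled_green k c G)"
    unfolding rescaled_green_def
    by (rule continuous_on_subset[OF continuous_on_rescale[OF contG]])
      (use c in \<open>auto simp: closure_dilate[OF c]\<close>)
  fix f assume f: "f \<in> holder_closure 0 \<theta> (dilate c \<Omega>)"
  define f' where "f' = (\<lambda>y. (1 / c) ^ (2 * k) * f ((1 / c) *\<^sub>R y))"
  have f': "f' \<in> holder_closure 0 \<theta> \<Omega>"
    using holder_closure_rescale[OF open_dilate[OF \<open>open \<Omega>\<close>] _ f, of "1 / c"] c
    by (simp add: f'_def dilate_dilate_inverse)
  have f'_scale: "f' (c *\<^sub>R y) = f y / c ^ (2 * k)" for y
    using c by (simp add: f'_def power_one_over)
  obtain u where "dirichlet_solution k \<theta> \<Omega> f' u"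
    using ex[OF f'] by blast
  from dirichlet_solution_rescale[OF \<open>open \<Omega>\<close> c this]
  show "\<exists>u. dirichlet_solution k \<theta> (dilate c \<Omega>) f u"
    using c by (auto simp: f'_scale)
  fix u x assume u: "dirichlet_solution k \<theta> (dilate c \<Omega>) f u" and x: "x \<in> closure (dilate c \<Omega>)"
  have "dirichlet_solution k \<theta> \<Omega> f' (\<lambda>y. u ((1 / c) *\<^sub>R y))"
    using dirichlet_solution_rescale[OF open_dilate[OF \<open>open \<Omega>\<close>] _ u, of "1 / c"] c
    by (simp add: dilate_dilate_inverse f'_def)
  from rep[OF f' this, of "c *\<^sub>R x"] x
  have int: "set_integrable lebesgue \<Omega> (\<lambda>y. G (c *\<^sub>R x, y) * f' y)"
    and u_eq: "u x = (LINT y:\<Omega>|lebesgue. G (c *\<^sub>R x, y) * f' y)"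
    using c by (auto simp: closure_dilate[OF c])
  let ?h = "\<lambda>y. indicator \<Omega> y *\<^sub>R (G (c *\<^sub>R x, y) * f' y)"
  have integrand: "indicator (dilate c \<Omega>) y *\<^sub>R (rescaled_green k c G (x, y) * f y)
      = c ^ DIM('a) * ?h (c *\<^sub>R y)" for y
    by (simp add: rescaled_green_def f'_scale indicator_def)
  have h: "integrable lebesgue ?h"
    using int by (simp add: set_integrable_def)
  show "set_integrable lebesgue (dilate c \<Omega>) (\<lambda>y. rescaled_green k c G (x, y) * f y)"
    unfolding set_integrable_def integrand
    by (intro integrable_mult_right integrable_lebesgue_rescale[OF c h])
  show "u x = (LINT y:dilate c \<Omega>|lebesgue. rescaled_green k c G (x, y) * f y)"
    using integral_lebesgue_rescale[OF c h]
    unfolding set_lebesgue_integral_def integrand u_eq by simp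
qed


section \<open>Essential and pointwise bounds off the diagonal\<close>

lemma closed_Id: "closed (Id :: ('a::t2_space \<times> 'a) set)"
  using closed_diagonal[where 'a = 'a] by (simp add: Id_def)

lemma negligible_Id: "negligible (Id :: ('a::euclidean_space \<times> 'a) set)"
proof -
  obtain b :: 'a where b: "b \<in> Basis" using nonempty_Basis by blast
  have "(Id :: ('a \<times> 'a) set) \<subseteq> {z. (b, - b) \<bullet> z = 0}"
    by auto
  moreover have "negligible {z. (b, - b) \<bullet> z = 0}"
    using b by (intro negligible_hyperplane) (auto simp: zero_prod_def)
  ultimately show ?thesis by (rule negligible_subset[rotated])
qed

text \<open>
  \<^const>\<open>esssup\<close> is infinite for non-measurable functions, so measurability of the negative part on all
  of \<open>\<Omega> \<times> \<Omega>\<close> has to be shown: it is continuous off the diagonal, and its arbitrary values on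
  the null diagonal do no harm for the complete Lebesgue measure.
\<close>

lemma Linf_norm_negative_part_le_zero:
  fixes G :: "'a::euclidean_space \<times> 'a \<Rightarrow> real"
  assumes "open \<Omega>" "continuous_on (\<Omega> \<times> \<Omega> - Id) G"
    and nonneg: "\<And>z. z \<in> \<Omega> \<times> \<Omega> - Id \<Longrightarrow> G z \<ge> 0"
  shows "Linf_norm (lebesgue_on (\<Omega> \<times> \<Omega>)) (negative_part G) \<le> 0"
proof -
  let ?M = "lebesgue_on (\<Omega> \<times> \<Omega>)" and ?F = "\<lambda>z. ereal \<bar>negative_part G z\<bar>"
  have leb: "\<Omega> \<times> \<Omega> \<in> sets lebesgue"
    using assms(1) by (simp add: open_Times borel_open)
  have zero: "?F z = 0" if "z \<in> \<Omega> \<times> \<Omega> - Id" for z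
    using nonneg[OF that] by (simp add: negative_part_def)
  have AE: "AE z in lebesgue. z \<notin> Id"
    using negligible_Id unfolding negligible_iff_null_sets by (rule AE_not_in)
  have "continuous_on (\<Omega> \<times> \<Omega> - Id) (negative_part G)"
    unfolding negative_part_def by (intro continuous_intros assms)
  then have "negative_part G \<in> borel_measurable (lebesgue_on (\<Omega> \<times> \<Omega> - Id))"
    using leb negligible_Id
    by (intro continuous_imp_measurable_on_sets_lebesgue) (auto intro: negligible_imp_sets)
  moreover have "\<Omega> \<times> \<Omega> - Id = \<Omega> \<times> \<Omega> - Id \<inter> \<Omega> \<times> \<Omega>" by blast
  moreover have "Id \<inter> \<Omega> \<times> \<Omega> \<in> null_sets ?M"
    using negligible_subset[OF negligible_Id, of "Id \<inter> \<Omega> \<times> \<Omega>"] leb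
    by (simp add: null_sets_restrict_space negligible_iff_null_sets)
  ultimately have "negative_part G \<in> borel_measurable ?M"
    using borel_measurable_diff_null[OF _ leb] by metis
  then have "?F \<in> borel_measurable ?M"
    by measurable
  moreover have "AE z in ?M. ?F z \<le> 0"
  proof -
    have "AE z in lebesgue. z \<in> \<Omega> \<times> \<Omega> \<longrightarrow> ?F z \<le> 0"
      using AE by (rule eventually_mono) (use zero in force)
    then show ?thesis
      using leb by (subst AE_restrict_space_iff) simp_all
  qed
  ultimately show ?thesis
    unfolding Linf_norm_def by (rule esssup_I)
qed

text \<open>
  By continuity a violation of the bound at one point would persist on a nonempty open set, which
  is not null.
\<close>

lemma pointwise_lower_bound_of_Linf_norm:
  fixes G :: "'a::euclidean_space \<times> 'a \<Rightarrow> real"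
  assumes "open \<Omega>" "continuous_on (\<Omega> \<times> \<Omega> - Id) G"
    and bound: "Linf_norm (lebesgue_on (\<Omega> \<times> \<Omega>)) (negative_part G) \<le> ereal C"
    and z: "z \<in> \<Omega> \<times> \<Omega> - Id"
  shows "- C \<le> G z"
proof (rule ccontr)
  assume "\<not> - C \<le> G z"
  define A where "A = (\<Omega> \<times> \<Omega> - Id) \<inter> G -` {..< - C}"
  have op: "open (\<Omega> \<times> \<Omega> - Id)"
    using assms(1) closed_Id by (auto intro: open_Diff open_Times)
  have "open A"
    unfolding A_def by (rule continuous_open_preimage[OF assms(2) op]) simp
  moreover have "z \<in> A"
    using z \<open>\<not> - C \<le> G z\<close> by (auto simp: A_def)
  ultimately have "\<not> negligible A"
    using open_not_negligible by blast
  moreover have "AE z in lebesgue_on (\<Omega> \<times> \<Omega>). ereal \<bar>negative_part G z\<bar> \<le> ereal C"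
    using esssup_AE[of "\<lambda>z. ereal \<bar>negative_part G z\<bar>" "lebesgue_on (\<Omega> \<times> \<Omega>)"]
    by (rule eventually_mono) (rule order_trans[OF _ bound[unfolded Linf_norm_def]])
  then have "AE z in lebesgue. z \<in> \<Omega> \<times> \<Omega> \<longrightarrow> \<bar>negative_part G z\<bar> \<le> C"
    using assms(1) by (subst (asm) AE_restrict_space_iff) (auto simp: open_Times borel_open)
  then have "AE z in lebesgue. z \<notin> A"
    by eventually_elim (auto simp: A_def negative_part_def)
  then have "negligible A"
    using \<open>open A\<close> by (simp add: negligible_iff_null_sets AE_iff_null_sets borel_open)
  ultimately show False by blast
qed

text \<open>
  Density of \<open>\<Omega> \<times> \<Omega>\<close> in the product of closures survives removing the diagonal because the
  complement of the diagonal is open.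
\<close>

lemma nonneg_off_diagonal_closure:
  fixes G :: "'a::euclidean_space \<times> 'a \<Rightarrow> real"
  assumes cont: "continuous_on (closure \<Omega> \<times> closure \<Omega> - Id) G"
    and nonneg: "\<And>z. z \<in> \<Omega> \<times> \<Omega> - Id \<Longrightarrow> G z \<ge> 0"
    and z: "z \<in> closure \<Omega> \<times> closure \<Omega> - Id"
  shows "G z \<ge> 0"
proof -
  let ?D = "closure \<Omega> \<times> closure \<Omega> - Id"
  have "closedin (top_of_set ?D) (?D \<inter> G -` {0..})"
    by (rule continuous_closedin_preimage[OF cont]) simp
  then obtain T where T: "closed T" "?D \<inter> G -` {0..} = ?D \<inter> T"
    by (auto simp: closedin_closed)
  have "\<Omega> \<times> \<Omega> - Id \<subseteq> ?D \<inter> G -` {0..}"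
    using nonneg closure_subset[of \<Omega>] by fastforce
  then have "closure (\<Omega> \<times> \<Omega> - Id) \<subseteq> T"
    using T by (intro closure_minimal) auto
  moreover have "?D \<subseteq> closure (\<Omega> \<times> \<Omega> - Id)"
    using open_Int_closure_subset[of "- Id" "\<Omega> \<times> \<Omega>"] closed_Id
    by (auto simp: closure_Times Diff_eq Int_commute)
  ultimately show ?thesis using z T by blast
qed

text \<open>The limit \<open>c \<rightarrow> \<infinity>\<close> of the scaling argument, with an explicit \<open>c\<close>.\<close>

lemma nonneg_of_scaled_bounds:
  fixes g C :: real
  assumes "n > 0" "\<And>c. c > 0 \<Longrightarrow> - C \<le> c ^ n * g"
  shows "g \<ge> 0"
proof (rule ccontr)
  assume "\<not> g \<ge> 0"
  \<comment> \<open>The second entry makes \<open>c * g \<le> - C - 1\<close>; the first makes \<open>c ^ n\<close> at least \<open>c\<close>.\<close>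
  define c where "c = max 1 ((C + 1) / (- g))"
  have "C + 1 \<le> c * (- g)"
    using \<open>\<not> g \<ge> 0\<close> by (simp add: c_def field_simps max_def)
  also have "\<dots> \<le> c ^ n * (- g)"
    using \<open>\<not> g \<ge> 0\<close> \<open>n > 0\<close> by (intro mult_right_mono self_le_power) (auto simp: c_def)
  finally have "C + 1 \<le> - (c ^ n * g)" by simp
  moreover have "c > 0" by (simp add: c_def)
  ultimately show False
    using assms(2)[of c] by simp
qed

section \<open>Uniform boundedness and nonnegativity of Green functions\<close>

theorem proposition2:
  fixes k :: nat and \<theta> :: real
  assumes "k \<ge> 1" and "CARD('n::finite) > 2 * k" and "0 < \<theta>" and "\<theta> < 1"
  shows "(\<exists>C::real. \<forall>(\<Omega>::(real^'n) set) G.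
            holder_smooth_bounded_domain (2 * k) \<theta> \<Omega> \<longrightarrow> is_green_function k \<theta> \<Omega> G \<longrightarrow>
            Linf_norm (lebesgue_on (\<Omega> \<times> \<Omega>)) (negative_part G) \<le> ereal C)
     \<longleftrightarrow> (\<forall>(\<Omega>::(real^'n) set) G.
            holder_smooth_bounded_domain (2 * k) \<theta> \<Omega> \<longrightarrow> is_green_function k \<theta> \<Omega> G \<longrightarrow>
            (\<forall>x\<in>closure \<Omega>. \<forall>y\<in>closure \<Omega>. x \<noteq> y \<longrightarrow> G (x, y) \<ge> 0))"
    (is "?bounded \<longleftrightarrow> ?nonneg")
proof
  have diag: "closure \<Omega> \<times> closure \<Omega> - {(x, x) |x. x \<in> closure \<Omega>}
      = closure \<Omega> \<times> closure \<Omega> - Id" for \<Omega> :: "(real^'n) set"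
    by auto
  have open_dom: "open \<Omega>" if "holder_smooth_bounded_domain (2 * k) \<theta> \<Omega>"
    for \<Omega> :: "(real^'n) set"
    using that by (simp add: holder_smooth_bounded_domain_def)
  have cont: "continuous_on (closure \<Omega> \<times> closure \<Omega> - Id) G" "continuous_on (\<Omega> \<times> \<Omega> - Id) G"
    if "is_green_function k \<theta> \<Omega> G" for \<Omega> :: "(real^'n) set" and G
  proof -
    show *: "continuous_on (closure \<Omega> \<times> closure \<Omega> - Id) G"
      using that by (simp add: is_green_function_def diag)
    show "continuous_on (\<Omega> \<times> \<Omega> - Id) G"
      by (rule continuous_on_subset[OF *]) (use closure_subset[of \<Omega>] in auto)
  qed
  {
    assume ?bounded
    then obtain C where C: "\<And>(\<Omega>::(real^'n) set) G. holder_smooth_bounded_domain (2 * k) \<theta> \<Omega> \<Longrightarrow>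
        is_green_function k \<theta> \<Omega> G \<Longrightarrow>
        Linf_norm (lebesgue_on (\<Omega> \<times> \<Omega>)) (negative_part G) \<le> ereal C"
      by blast
    show ?nonneg
    proof (intro allI impI ballI)
      fix \<Omega> :: "(real^'n) set" and G x y
      assume dom: "holder_smooth_bounded_domain (2 * k) \<theta> \<Omega>" and G: "is_green_function k \<theta> \<Omega> G"
        and xy: "x \<in> closure \<Omega>" "y \<in> closure \<Omega>" "x \<noteq> y"
      have nonneg: "G z \<ge> 0" if z: "z \<in> \<Omega> \<times> \<Omega> - Id" for z
      proof (rule nonneg_of_scaled_bounds)
        show "CARD('n) - 2 * k > 0" using assms(2) by simp
        fix c :: real assume c: "c > 0"
        have green: "is_green_function k \<theta> (dilate c \<Omega>) (rescaled_green k c G)"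
          by (rule is_green_function_rescale[OF open_dom[OF dom] c G])
        \<comment> \<open>The point \<open>(1 / c) *\<^sub>R z\<close> of the dilated domain is where \<open>G\<close> is evaluated at \<open>z\<close>.\<close>
        have "- C \<le> rescaled_green k c G ((1 / c) *\<^sub>R z)"
        proof (rule pointwise_lower_bound_of_Linf_norm)
          show "open (dilate c \<Omega>)" by (rule open_dilate[OF open_dom[OF dom]])
          show "continuous_on (dilate c \<Omega> \<times> dilate c \<Omega> - Id) (rescaled_green k c G)"
            by (rule cont(2)[OF green])
          show "Linf_norm (lebesgue_on (dilate c \<Omega> \<times> dilate c \<Omega>))
              (negative_part (rescaled_green k c G)) \<le> ereal C"
            by (rule C[OF holder_smooth_bounded_domain_dilate[OF dom c] green])
          show "(1 / c) *\<^sub>R z \<in> dilate c \<Omega> \<times> dilate c \<Omega> - Id"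
            using z c by (cases z) (simp add: mem_Times_iff)
        qed
        also have "rescaled_green k c G ((1 / c) *\<^sub>R z) = c ^ (CARD('n) - 2 * k) * G z"
          using c assms(2) by (simp add: rescaled_green_def power_diff)
        finally show "- C \<le> c ^ (CARD('n) - 2 * k) * G z" .
      qed
      show "G (x, y) \<ge> 0"
        by (rule nonneg_off_diagonal_closure[OF cont(1)[OF G] nonneg]) (use xy in simp_all)
    qed
  next
    assume nonneg: ?nonneg
    have "Linf_norm (lebesgue_on (\<Omega> \<times> \<Omega>)) (negative_part G) \<le> 0"
      if dom: "holder_smooth_bounded_domain (2 * k) \<theta> \<Omega>" and green: "is_green_function k \<theta> \<Omega> G"
      for \<Omega> :: "(real^'n) set" and G
    proof (rule Linf_norm_negative_part_le_zero[OF open_dom[OF dom] cont(2)[OF green]])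
      show "G z \<ge> 0" if "z \<in> \<Omega> \<times> \<Omega> - Id" for z
      proof -
        have "fst z \<in> closure \<Omega>" "snd z \<in> closure \<Omega>" "fst z \<noteq> snd z"
          using that closure_subset[of \<Omega>] by (cases z; auto)+
        then have "G (fst z, snd z) \<ge> 0"
          using nonneg[rule_format, OF dom green] by blast
        then show ?thesis by simp
      qed
    qed
    then show ?bounded by (intro exI[of _ 0]) (simp flip: zero_ereal_def)
  }
qed

end
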